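(* Let $\Gamma$ be a finitely generated group and let $\widehat\Gamma$ be its profinite completion. Then for every positive integer $n$, $$ i_\Gamma(n)=i_{\widehat\Gamma}(n),\quad i^{\lhd}_\Gamma(n)=i^{\lhd}_{\widehat\Gamma}(n),\quad i^{\max}_\Gamma(n)=i^{\max}_{\widehat\Gamma}(n),\quad i^{\max\lhd}_\Gamma(n)=i^{\max\lhd}_{\widehat\Gamma}(n).$$
   Context: The profinite completion $\widehat\Gamma$ is the inverse limit of the finite quotients of $\Gamma$, as a topological group. For a group $G$ and $n>0$: $i_G(n)$, $i^{\lhd}_G(n)$, $i^{\max}_G(n)$, $i^{\max\lhd}_G(n)$ denote the index in $G$ of the intersection of, respectively, all subgroups, all normal subgroups, all maximal (proper) subgroups, all maximal normal subgroups (subgroups maximal among the proper normal subgroups) of $G$ of index at most $n$; an empty intersection is $G$. For $G=\widehat\Gamma$ the functions may equivalently be defined using all finite-index subgroups or only closed finite-index subgroups, since by a theorem of Nikolov and Segal every finite-index subgroup of a topologically finitely generated profinite group is closed. *)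

theory Defs
  imports
    "HOL-Analysis.Function_Topology"
    "HOL-Algebra.Product_Groups"
    "HOL-Algebra.Generated_Groups"
    "HOL-Library.Extended_Nat"
begin

definition finitely_generated_group :: "('a, 'b) monoid_scheme \<Rightarrow> bool" where
  "finitely_generated_group G \<longleftrightarrow>
     group G \<and> (\<exists>S. finite S \<and> S \<subseteq> carrier G \<and> generate G S = carrier G)"

text \<open>The index is extended-valued, so that an infinite index is never confused with \<open>card = 0\<close>;
  in particular \<open>subgroup_index G H \<le> enat n\<close> implies that \<open>H\<close> has finite index.\<close>

definition subgroup_index :: "('a, 'b) monoid_scheme \<Rightarrow> 'a set \<Rightarrow> enat" where
  "subgroup_index G H =
     (if finite (rcosets\<^bsub>G\<^esub> H) then enat (card (rcosets\<^bsub>G\<^esub> H)) else \<infinity>)"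

definition maximal_subgroup :: "'a set \<Rightarrow> ('a, 'b) monoid_scheme \<Rightarrow> bool" where
  "maximal_subgroup M G \<longleftrightarrow>
     subgroup M G \<and> M \<noteq> carrier G \<and>
     (\<forall>H. subgroup H G \<and> M \<subseteq> H \<and> H \<noteq> carrier G \<longrightarrow> H = M)"

definition maximal_normal_subgroup :: "'a set \<Rightarrow> ('a, 'b) monoid_scheme \<Rightarrow> bool" where
  "maximal_normal_subgroup M G \<longleftrightarrow>
     M \<lhd> G \<and> M \<noteq> carrier G \<and>
     (\<forall>H. H \<lhd> G \<and> M \<subseteq> H \<and> H \<noteq> carrier G \<longrightarrow> H = M)"


subsection \<open>The index functions\<close>

text \<open>The intersection with \<open>carrier G\<close> makes the empty intersection equal to \<open>G\<close>.\<close>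

definition intersection_index ::
    "('a, 'b) monoid_scheme \<Rightarrow> ('a set \<Rightarrow> bool) \<Rightarrow> nat \<Rightarrow> enat" where
  "intersection_index G P n =
     subgroup_index G (carrier G \<inter> \<Inter>{H. P H \<and> subgroup_index G H \<le> enat n})"

definition i_sub :: "('a, 'b) monoid_scheme \<Rightarrow> nat \<Rightarrow> enat" where
  "i_sub G = intersection_index G (\<lambda>H. subgroup H G)"

definition i_normal :: "('a, 'b) monoid_scheme \<Rightarrow> nat \<Rightarrow> enat" where
  "i_normal G = intersection_index G (\<lambda>H. H \<lhd> G)"

definition i_max :: "('a, 'b) monoid_scheme \<Rightarrow> nat \<Rightarrow> enat" where
  "i_max G = intersection_index G (\<lambda>H. maximal_subgroup H G)"

definition i_max_normal :: "('a, 'b) monoid_scheme \<Rightarrow> nat \<Rightarrow> enat" where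
  "i_max_normal G = intersection_index G (\<lambda>H. maximal_normal_subgroup H G)"

text \<open>For a topological group \<open>(G, T)\<close> only closed subgroups are taken into account. (For
  topologically finitely generated profinite groups this is no restriction, by the theorem of
  Nikolov and Segal.) Maximality still refers to all subgroups: a closed subgroup of finite index
  is open, hence so is every subgroup above it, and maximality among the closed subgroups is the
  same condition.\<close>

definition i_sub_closed :: "('a, 'b) monoid_scheme \<Rightarrow> 'a topology \<Rightarrow> nat \<Rightarrow> enat" where
  "i_sub_closed G T = intersection_index G (\<lambda>H. subgroup H G \<and> closedin T H)"

definition i_normal_closed :: "('a, 'b) monoid_scheme \<Rightarrow> 'a topology \<Rightarrow> nat \<Rightarrow> enat" where
  "i_normal_closed G T = intersection_index G (\<lambda>H. H \<lhd> G \<and> closedin T H)"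

definition i_max_closed :: "('a, 'b) monoid_scheme \<Rightarrow> 'a topology \<Rightarrow> nat \<Rightarrow> enat" where
  "i_max_closed G T = intersection_index G (\<lambda>H. maximal_subgroup H G \<and> closedin T H)"

definition i_max_normal_closed :: "('a, 'b) monoid_scheme \<Rightarrow> 'a topology \<Rightarrow> nat \<Rightarrow> enat" where
  "i_max_normal_closed G T =
     intersection_index G (\<lambda>H. maximal_normal_subgroup H G \<and> closedin T H)"


subsection \<open>Profinite completion\<close>

definition finite_index_normal :: "('a, 'b) monoid_scheme \<Rightarrow> 'a set set" where
  "finite_index_normal G = {N. N \<lhd> G \<and> finite (rcosets\<^bsub>G\<^esub> N)}"

text \<open>For \<open>N \<subseteq> M\<close> the canonical map \<open>G Mod N \<rightarrow> G Mod M\<close> sends a coset \<open>C\<close> of \<open>N\<close> to \<open>M C\<close>.\<close>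

definition profinite_completion :: "('a, 'b) monoid_scheme \<Rightarrow> ('a set \<Rightarrow> 'a set) monoid" where
  "profinite_completion G =
     (product_group (finite_index_normal G) (\<lambda>N. G Mod N))
       \<lparr>carrier := {f \<in> (\<Pi>\<^sub>E N \<in> finite_index_normal G. carrier (G Mod N)).
          \<forall>N \<in> finite_index_normal G. \<forall>M \<in> finite_index_normal G.
            N \<subseteq> M \<longrightarrow> f M = M <#>\<^bsub>G\<^esub> f N}\<rparr>"

definition profinite_topology :: "('a, 'b) monoid_scheme \<Rightarrow> ('a set \<Rightarrow> 'a set) topology" where
  "profinite_topology G =
     subtopology
       (product_topology (\<lambda>N. discrete_topology (carrier (G Mod N))) (finite_index_normal G))
       (carrier (profinite_completion G))"

end

theory Submission
  imports Defs
begin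

text \<open>The canonical homomorphism \<open>\<phi>\<close> from \<open>\<Gamma>\<close> to its profinite completion has dense image, and the kernels
  \<open>W\<^sub>N\<close> of the projections to the finite quotients \<open>\<Gamma>/N\<close> form a base of open normal subgroups with
  \<open>\<phi>\<^sup>-\<^sup>1(W\<^sub>N) = N\<close>. A closed subgroup of finite index is open, so it contains some \<open>W\<^sub>N\<close>
  (\<open>openin_if_closedin_finite_index\<close>, \<open>contains_congruence_kernel_if_openin\<close>); conversely a subgroup that
  contains some \<open>W\<^sub>N\<close> is closed, as it is cut out by one coordinate. In \<open>\<Gamma>\<close> a subgroup of finite index
  contains some \<open>N\<close>, namely its normal core (\<open>finite_index_contains_normal\<close>).

  By density, \<open>V \<mapsto> \<phi>\<^sup>-\<^sup>1(V)\<close> is a bijection from the subgroups above \<open>W\<^sub>N\<close> onto the subgroups of \<open>\<Gamma>\<close> above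
  \<open>N\<close>, with inverse \<open>K \<mapsto> W\<^sub>N \<phi>(K)\<close>. It preserves and reflects inclusion and normality, hence maximality in
  either sense, and it preserves the index (\<open>index_pullback\<close>, \<open>normal_iff_pullback_normal\<close>,
  \<open>maximal_iff_pullback_maximal\<close>). So for each of the four kinds of subgroups, the family to be intersected
  in the completion corresponds to the family to be intersected in \<open>\<Gamma>\<close>.

  It remains to compare the indices of the two intersections \<open>V\<close> and \<open>K = \<phi>\<^sup>-\<^sup>1(V)\<close>. If \<open>K\<close> has infinite
  index, so has \<open>V\<close>. Otherwise \<open>K\<close> contains some \<open>N\<close>, so every subgroup in the family above contains
  \<open>W\<^sub>N\<close>; hence \<open>V\<close> does, and \<open>V\<close> and \<open>K\<close> have the same index by the correspondence. This argument is
  \<open>intersection_index_eq\<close>, for homomorphisms with the properties of \<open>\<phi>\<close> just listed.\<close>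

section \<open>Cosets and finite index\<close>

lemma (in group) rcos_eq_iff:
  assumes "subgroup H G" "x \<in> carrier G" "y \<in> carrier G"
  shows "H #> x = H #> y \<longleftrightarrow> x \<otimes> inv y \<in> H"
  using assms coset_mult_inv1 coset_mult_inv2 coset_join1 coset_join2 subgroup.subset
  by (metis inv_closed m_closed)

text \<open>The shape in which finiteness of an index is checked throughout: a map with finite image whose
  fibres lie in single cosets.\<close>

lemma (in group) finite_rcosets_if_separated:
  assumes "subgroup H G" "finite (f ` carrier G)"
    and "\<And>x y. \<lbrakk>x \<in> carrier G; y \<in> carrier G; f x = f y\<rbrakk> \<Longrightarrow> x \<otimes> inv y \<in> H"
  shows "finite (rcosets H)"
proof -
  have eq: "H #> x = H #> y" if "x \<in> carrier G" "y \<in> carrier G" "f x = f y" for x y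
    using rcos_eq_iff assms(1,3) that by blast
  have "rcosets H \<subseteq> (\<lambda>v. H #> (SOME x. x \<in> carrier G \<and> f x = v)) ` f ` carrier G"
  proof
    fix C assume "C \<in> rcosets H"
    then obtain x where x: "x \<in> carrier G" "C = H #> x"
      by (auto simp: RCOSETS_def)
    have "(SOME x'. x' \<in> carrier G \<and> f x' = f x) \<in> carrier G \<and> f (SOME x'. x' \<in> carrier G \<and> f x' = f x) = f x"
      by (rule someI[of "\<lambda>x'. x' \<in> carrier G \<and> f x' = f x" x]) (simp add: x)
    then have "C = H #> (SOME x'. x' \<in> carrier G \<and> f x' = f x)"
      using eq x by metis
    then show "C \<in> (\<lambda>v. H #> (SOME x. x \<in> carrier G \<and> f x = v)) ` f ` carrier G"
      using x(1) by blast
  qed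
  then show ?thesis
    using assms(2) finite_surj by blast
qed

lemma (in group) finite_rcosets_Int:
  assumes "subgroup H G" "subgroup K G" "finite (rcosets H)" "finite (rcosets K)"
  shows "finite (rcosets (H \<inter> K))"
proof (rule finite_rcosets_if_separated[where f = "\<lambda>x. (H #> x, K #> x)"])
  show "subgroup (H \<inter> K) G"
    using assms subgroups_Inter_pair by blast
  have "(\<lambda>x. (H #> x, K #> x)) ` carrier G \<subseteq> (rcosets H) \<times> (rcosets K)"
    by (auto simp: RCOSETS_def)
  then show "finite ((\<lambda>x. (H #> x, K #> x)) ` carrier G)"
    using assms(3,4) finite_subset by blast
qed (use assms rcos_eq_iff in blast)

lemma (in group) rcosets_r_coset_closed:
  assumes "H \<subseteq> carrier G" "C \<in> rcosets H" "x \<in> carrier G"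
  shows "C #> x \<in> rcosets H"
  using assms by (auto simp: RCOSETS_def coset_mult_assoc)

text \<open>The normal core: the kernel of the action of \<open>G\<close> on the cosets of \<open>H\<close> by translation. It has
  finite index because an element is determined modulo the kernel by its action on a finite set.\<close>

lemma (in group) finite_index_contains_normal:
  assumes H: "subgroup H G" and fin: "finite (rcosets H)"
  shows "\<exists>N. N \<lhd> G \<and> finite (rcosets N) \<and> N \<subseteq> H"
proof -
  define N where "N = {g \<in> carrier G. \<forall>C \<in> rcosets H. C #> g = C}"
  have sub: "C \<subseteq> carrier G" if "C \<in> rcosets H" for C
    using that H by (metis subgroup.rcosets_carrier is_group)
  have tr: "C #> g \<in> rcosets H" if "C \<in> rcosets H" "g \<in> carrier G" for C g
    using rcosets_r_coset_closed[OF subgroup.subset[OF H]] that by blast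
  have inv_fix: "C #> g = C \<Longrightarrow> C #> inv g = C" if "C \<in> rcosets H" "g \<in> carrier G" for C g
    using that sub by (metis coset_mult_assoc coset_mult_one inv_closed r_inv)
  have N_sub: "subgroup N G"
  proof (rule subgroupI)
    show "N \<noteq> {}"
      using sub by (auto simp: N_def intro!: exI[of _ \<one>])
  next
    fix a b assume "a \<in> N" "b \<in> N"
    then show "a \<otimes> b \<in> N"
      using sub by (auto simp: N_def simp flip: coset_mult_assoc)
  qed (auto simp: N_def inv_fix)
  have "N \<lhd> G"
  proof (rule normal_invI[OF N_sub])
    fix x g assume x: "x \<in> carrier G" and g: "g \<in> N"
    then have gc: "g \<in> carrier G"
      by (simp add: N_def)
    have "C #> (x \<otimes> g \<otimes> inv x) = C" if C: "C \<in> rcosets H" for C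
    proof -
      have "C #> (x \<otimes> g \<otimes> inv x) = ((C #> x) #> g) #> inv x"
        using sub[OF C] x gc by (simp add: coset_mult_assoc r_coset_subset_G m_assoc)
      also have "(C #> x) #> g = C #> x"
        using g tr[OF C x] by (simp add: N_def)
      also have "(C #> x) #> inv x = C"
        using sub[OF C] x by (simp add: coset_mult_assoc)
      finally show ?thesis .
    qed
    then show "x \<otimes> g \<otimes> inv x \<in> N"
      using x gc by (simp add: N_def)
  qed
  moreover have "finite (rcosets N)"
  proof (rule finite_rcosets_if_separated[OF N_sub, where f = "\<lambda>g. \<lambda>C\<in>rcosets H. C #> g"])
    have "(\<lambda>g. \<lambda>C\<in>rcosets H. C #> g) ` carrier G \<subseteq> (rcosets H) \<rightarrow>\<^sub>E (rcosets H)"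
      using tr by auto
    then show "finite ((\<lambda>g. \<lambda>C\<in>rcosets H. C #> g) ` carrier G)"
      using fin finite_PiE finite_subset by meson
  next
    fix x y assume x: "x \<in> carrier G" and y: "y \<in> carrier G"
      and eq: "(\<lambda>C\<in>rcosets H. C #> x) = (\<lambda>C\<in>rcosets H. C #> y)"
    have "C #> (x \<otimes> inv y) = C" if C: "C \<in> rcosets H" for C
    proof -
      have "C #> x = C #> y"
        using fun_cong[OF eq, of C] C by simp
      then show ?thesis
        using coset_mult_inv2 sub[OF C] x y by blast
    qed
    then show "x \<otimes> inv y \<in> N"
      using x y by (simp add: N_def)
  qed
  moreover have "N \<subseteq> H"
  proof
    fix g assume "g \<in> N"
    moreover have "H \<in> rcosets H"
      using H subgroup.subgroup_in_rcosets is_group by blast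
    ultimately show "g \<in> H"
      using coset_join1 H by (auto simp: N_def)
  qed
  ultimately show ?thesis
    by blast
qed

lemma (in group) finite_index_normal_Int:
  assumes "M \<in> finite_index_normal G" "N \<in> finite_index_normal G"
  shows "M \<inter> N \<in> finite_index_normal G"
  using assms normal_subgroup_intersect finite_rcosets_Int
  by (auto simp: finite_index_normal_def normal_imp_subgroup)

lemma (in group) carrier_finite_index_normal: "carrier G \<in> finite_index_normal G"
proof -
  have "carrier G \<lhd> G"
    by (rule normal_invI[OF subgroup_self]) auto
  moreover have "finite (rcosets (carrier G))"
    by (rule finite_rcosets_if_separated[OF subgroup_self, where f = "\<lambda>_. ()"]) auto
  ultimately show ?thesis
    by (simp add: finite_index_normal_def)
qed

lemma (in group) finite_index_normal_Inter:
  assumes "finite \<J>" "\<J> \<subseteq> finite_index_normal G"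
  shows "carrier G \<inter> \<Inter>\<J> \<in> finite_index_normal G"
  using assms
proof (induction \<J> rule: finite_induct)
  case (insert N \<J>)
  then show ?case
    using finite_index_normal_Int[of N "carrier G \<inter> \<Inter>\<J>"] by (simp add: Int_left_commute)
qed (simp add: carrier_finite_index_normal)

section \<open>Pulling subgroups back along a homomorphism with dense image\<close>

context group_hom
begin

abbreviation pullback :: "'c set \<Rightarrow> 'a set"
  where "pullback V \<equiv> h -` V \<inter> carrier G"

lemma subgroup_pullback:
  assumes "subgroup V H" shows "subgroup (pullback V) G"
proof (rule G.subgroupI)
  have "\<one> \<in> pullback V"
    using assms by (simp add: subgroup.one_closed)
  then show "pullback V \<noteq> {}"
    by blast
qed (use assms in \<open>auto simp: subgroup.m_closed subgroup.m_inv_closed\<close>)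

lemma normal_pullback:
  assumes "V \<lhd> H" shows "pullback V \<lhd> G"
  using assms subgroup_pullback
  by (intro G.normal_invI) (auto simp: H.normal_inv_iff)

lemma pullback_rcos_eq_iff:
  assumes "subgroup V H" "x \<in> carrier G" "y \<in> carrier G"
  shows "pullback V #> x = pullback V #> y \<longleftrightarrow> V #>\<^bsub>H\<^esub> h x = V #>\<^bsub>H\<^esub> h y"
  using assms by (simp add: G.rcos_eq_iff H.rcos_eq_iff subgroup_pullback)

lemma finite_rcosets_pullback:
  assumes "subgroup V H" "finite (rcosets\<^bsub>H\<^esub> V)"
  shows "finite (rcosets (pullback V))"
proof (rule G.finite_rcosets_if_separated[OF subgroup_pullback[OF assms(1)],
      where f = "\<lambda>x. V #>\<^bsub>H\<^esub> h x"])
  have "(\<lambda>x. V #>\<^bsub>H\<^esub> h x) ` carrier G \<subseteq> rcosets\<^bsub>H\<^esub> V"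
    using H.rcosetsI[OF subgroup.subset[OF assms(1)]] by auto
  then show "finite ((\<lambda>x. V #>\<^bsub>H\<^esub> h x) ` carrier G)"
    using assms(2) finite_subset by blast
qed (use assms(1) in \<open>simp add: H.rcos_eq_iff\<close>)

text \<open>Equivalently \<open>V h(G) = H\<close>. For all \<open>V\<close> in a neighbourhood base at \<open>\<one>\<close> of open subgroups of a
  topological group \<open>H\<close>, this says that \<open>h\<close> has dense image.\<close>

definition dense_modulo :: "'c set \<Rightarrow> bool"
  where "dense_modulo V \<longleftrightarrow> (\<forall>y \<in> carrier H. \<exists>x \<in> carrier G. y \<otimes>\<^bsub>H\<^esub> inv\<^bsub>H\<^esub> h x \<in> V)"

lemma dense_modulo_mono: "dense_modulo W \<Longrightarrow> W \<subseteq> V \<Longrightarrow> dense_modulo V"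
  unfolding dense_modulo_def by blast

text \<open>The coset of \<open>h\<^sup>-\<^sup>1(V)\<close> through \<open>x\<close> goes to the coset of \<open>V\<close> through \<open>h x\<close>. This is well defined
  and injective for every \<open>V\<close>; density modulo \<open>V\<close> is exactly surjectivity.\<close>

lemma index_pullback:
  assumes V: "subgroup V H" and "dense_modulo V"
  shows "subgroup_index G (pullback V) = subgroup_index H V"
proof -
  \<comment> \<open>a formula for the coset map that needs no choice of representatives\<close>
  define \<beta> where "\<beta> C = V <#>\<^bsub>H\<^esub> h ` C" for C
  have \<beta>: "\<beta> (pullback V #> x) = V #>\<^bsub>H\<^esub> h x" if x: "x \<in> carrier G" for x
  proof -
    have "v \<otimes>\<^bsub>H\<^esub> (h k \<otimes>\<^bsub>H\<^esub> h x) \<in> V #>\<^bsub>H\<^esub> h x" if "v \<in> V" "k \<in> pullback V" for v k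
    proof -
      have "v \<otimes>\<^bsub>H\<^esub> (h k \<otimes>\<^bsub>H\<^esub> h x) = (v \<otimes>\<^bsub>H\<^esub> h k) \<otimes>\<^bsub>H\<^esub> h x"
        using V that x by (simp add: H.m_assoc subgroup.mem_carrier)
      then show ?thesis
        using V that by (auto simp: r_coset_def subgroup.m_closed)
    qed
    moreover have "v \<otimes>\<^bsub>H\<^esub> h x \<in> \<beta> (pullback V #> x)" if "v \<in> V" for v
      using that x G.rcos_self[OF x subgroup_pullback[OF V]]
      by (auto simp: \<beta>_def set_mult_def)
    ultimately show ?thesis
      using x by (fastforce simp: \<beta>_def set_mult_def r_coset_def)
  qed
  have "bij_betw \<beta> (rcosets (pullback V)) (rcosets\<^bsub>H\<^esub> V)"
  proof (rule bij_betw_imageI)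
    show "inj_on \<beta> (rcosets (pullback V))"
      using V by (auto simp: inj_on_def RCOSETS_def \<beta> pullback_rcos_eq_iff)
    have "\<exists>x \<in> carrier G. V #>\<^bsub>H\<^esub> y = V #>\<^bsub>H\<^esub> h x" if "y \<in> carrier H" for y
      using assms that by (metis dense_modulo_def H.rcos_eq_iff hom_closed)
    then show "\<beta> ` (rcosets (pullback V)) = rcosets\<^bsub>H\<^esub> V"
      by (fastforce simp: RCOSETS_def \<beta> image_iff)
  qed
  then show ?thesis
    by (simp add: subgroup_index_def bij_betw_finite bij_betw_same_card)
qed

text \<open>An element of \<open>V\<close> can be moved into \<open>h(G)\<close> by an element of \<open>W\<close>, and \<open>W\<close> lies in both \<open>V\<close> and
  \<open>V'\<close>. So above \<open>W\<close> a subgroup is determined by its pullback, and inclusions can be tested there.\<close>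

lemma subset_if_pullback_subset:
  assumes "subgroup V H" "subgroup V' H" "W \<subseteq> V" "W \<subseteq> V'" "dense_modulo W"
    and sub: "pullback V \<subseteq> pullback V'"
  shows "V \<subseteq> V'"
proof
  fix y assume y: "y \<in> V"
  then have yc: "y \<in> carrier H"
    using assms(1) subgroup.mem_carrier by fast
  then obtain x where x: "x \<in> carrier G" and w: "y \<otimes>\<^bsub>H\<^esub> inv\<^bsub>H\<^esub> h x \<in> W"
    using assms(5) by (auto simp: dense_modulo_def)
  have "V #>\<^bsub>H\<^esub> y = V #>\<^bsub>H\<^esub> h x" "V' #>\<^bsub>H\<^esub> y = V' #>\<^bsub>H\<^esub> h x"
    using assms w x yc H.rcos_eq_iff by auto
  then have "h x \<in> V"
    using y x yc assms(1) by (metis H.coset_join1 H.coset_join2 hom_closed)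
  then have "h x \<in> V'"
    using sub x by blast
  then show "y \<in> V'"
    using \<open>V' #>\<^bsub>H\<^esub> y = V' #>\<^bsub>H\<^esub> h x\<close> x yc assms(2)
    by (metis H.coset_join1 H.coset_join2 hom_closed)
qed

lemma pullback_eq_iff:
  assumes "subgroup V H" "subgroup V' H" "W \<subseteq> V" "W \<subseteq> V'" "dense_modulo W"
  shows "pullback V = pullback V' \<longleftrightarrow> V = V'"
  using assms subset_if_pullback_subset by (metis order_refl subset_antisym)

text \<open>The product \<open>W h(K)\<close>. It inverts the pullback on subgroups above \<open>W\<close>, which gives the surjectivity
  half of the correspondence.\<close>

definition saturation :: "'c set \<Rightarrow> 'a set \<Rightarrow> 'c set"
  where "saturation W K = {y \<in> carrier H. \<exists>x \<in> K. W #>\<^bsub>H\<^esub> y = W #>\<^bsub>H\<^esub> h x}"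

lemma subgroup_saturation:
  assumes W: "W \<lhd> H" and K: "subgroup K G"
  shows "subgroup (saturation W K) H"
proof (rule H.subgroupI)
  note Kc = subgroup.mem_carrier[OF K]
  have "\<one>\<^bsub>H\<^esub> \<in> saturation W K"
    using subgroup.one_closed[OF K] by (force simp: saturation_def)
  then show "saturation W K \<noteq> {}"
    by blast
  show "inv\<^bsub>H\<^esub> y \<in> saturation W K" if y: "y \<in> saturation W K" for y
  proof -
    obtain x where x: "x \<in> K" and "y \<in> carrier H" "W #>\<^bsub>H\<^esub> y = W #>\<^bsub>H\<^esub> h x"
      using y by (auto simp: saturation_def)
    then have "W #>\<^bsub>H\<^esub> inv\<^bsub>H\<^esub> y = W #>\<^bsub>H\<^esub> h (inv x)"
      using normal.rcos_inv[OF W] Kc by (metis hom_closed hom_inv)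
    then show ?thesis
      using x y subgroup.m_inv_closed[OF K] by (auto simp: saturation_def)
  qed
  show "y \<otimes>\<^bsub>H\<^esub> y' \<in> saturation W K" if y: "y \<in> saturation W K" "y' \<in> saturation W K" for y y'
  proof -
    obtain x x' where x: "x \<in> K" "x' \<in> K" and "y \<in> carrier H" "W #>\<^bsub>H\<^esub> y = W #>\<^bsub>H\<^esub> h x"
      "y' \<in> carrier H" "W #>\<^bsub>H\<^esub> y' = W #>\<^bsub>H\<^esub> h x'"
      using y by (auto simp: saturation_def)
    then have "W #>\<^bsub>H\<^esub> (y \<otimes>\<^bsub>H\<^esub> y') = W #>\<^bsub>H\<^esub> h (x \<otimes> x')"
      using normal.rcos_sum[OF W] Kc by (metis hom_closed hom_mult)
    then show ?thesis
      using x y subgroup.m_closed[OF K] by (auto simp: saturation_def)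
  qed
qed (auto simp: saturation_def)

lemma subset_saturation:
  assumes "W \<lhd> H" "subgroup K G"
  shows "W \<subseteq> saturation W K"
proof
  fix w assume w: "w \<in> W"
  have W: "subgroup W H"
    using assms(1) by (rule normal_imp_subgroup)
  then have "w \<in> carrier H" "W #>\<^bsub>H\<^esub> w = W #>\<^bsub>H\<^esub> h \<one>"
    using w by (auto simp: subgroup.mem_carrier H.coset_join2 subgroup.subset)
  then show "w \<in> saturation W K"
    using subgroup.one_closed[OF assms(2)] by (force simp: saturation_def)
qed

lemma pullback_saturation:
  assumes W: "W \<lhd> H" and K: "subgroup K G" and sub: "pullback W \<subseteq> K"
  shows "pullback (saturation W K) = K"
proof (intro equalityI subsetI)
  fix x assume "x \<in> K"
  then show "x \<in> pullback (saturation W K)"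
    using subgroup.mem_carrier[OF K] by (auto simp: saturation_def)
next
  fix x assume "x \<in> pullback (saturation W K)"
  then obtain k where k: "k \<in> K" and x: "x \<in> carrier G" and "W #>\<^bsub>H\<^esub> h x = W #>\<^bsub>H\<^esub> h k"
    by (auto simp: saturation_def)
  moreover have kc: "k \<in> carrier G"
    using k K subgroup.mem_carrier by fast
  ultimately have "x \<otimes> inv k \<in> K"
    using sub W H.rcos_eq_iff[OF normal_imp_subgroup[OF W], of "h x" "h k"] by auto
  then have "x \<otimes> inv k \<otimes> k \<in> K"
    using k K subgroup.m_closed by fast
  then show "x \<in> K"
    using x kc by (simp add: G.m_assoc)
qed

text \<open>Modulo \<open>W\<close>, conjugation by an element of \<open>H\<close> agrees with conjugation by some \<open>h g\<close>, and \<open>K\<close> is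
  invariant under conjugation by \<open>g\<close>.\<close>

lemma normal_saturation:
  assumes W: "W \<lhd> H" and dense: "dense_modulo W" and K: "K \<lhd> G"
  shows "saturation W K \<lhd> H"
proof (rule H.normal_invI[OF subgroup_saturation[OF W normal_imp_subgroup[OF K]]])
  fix z y assume z: "z \<in> carrier H" and "y \<in> saturation W K"
  then obtain x where y: "y \<in> carrier H" and x: "x \<in> K" and yx: "W #>\<^bsub>H\<^esub> y = W #>\<^bsub>H\<^esub> h x"
    by (auto simp: saturation_def)
  obtain g where g: "g \<in> carrier G" and zg: "W #>\<^bsub>H\<^esub> z = W #>\<^bsub>H\<^esub> h g"
    using dense z H.rcos_eq_iff[OF normal_imp_subgroup[OF W]] by (auto simp: dense_modulo_def)
  have xc: "x \<in> carrier G"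
    using x K by (meson normal_imp_subgroup subgroup.mem_carrier)
  have zg': "W #>\<^bsub>H\<^esub> inv\<^bsub>H\<^esub> z = W #>\<^bsub>H\<^esub> h (inv g)"
    using zg z g normal.rcos_inv[OF W] by (metis hom_closed hom_inv)
  have "W #>\<^bsub>H\<^esub> (z \<otimes>\<^bsub>H\<^esub> y \<otimes>\<^bsub>H\<^esub> inv\<^bsub>H\<^esub> z) = (W #>\<^bsub>H\<^esub> h g) <#>\<^bsub>H\<^esub> (W #>\<^bsub>H\<^esub> h x) <#>\<^bsub>H\<^esub> (W #>\<^bsub>H\<^esub> h (inv g))"
    using z y normal.rcos_sum[OF W] by (simp flip: zg yx zg')
  also have "\<dots> = W #>\<^bsub>H\<^esub> h (g \<otimes> x \<otimes> inv g)"
    using g xc normal.rcos_sum[OF W] by simp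
  finally show "z \<otimes>\<^bsub>H\<^esub> y \<otimes>\<^bsub>H\<^esub> inv\<^bsub>H\<^esub> z \<in> saturation W K"
    using z y g x G.normal_invE(2)[OF K] by (auto simp: saturation_def)
qed

lemma normal_iff_pullback_normal:
  assumes W: "W \<lhd> H" "dense_modulo W" and V: "subgroup V H" "W \<subseteq> V"
  shows "V \<lhd> H \<longleftrightarrow> pullback V \<lhd> G"
proof
  assume N: "pullback V \<lhd> G"
  then have K: "subgroup (pullback V) G"
    by (rule normal_imp_subgroup)
  have "pullback (saturation W (pullback V)) = pullback V"
    using pullback_saturation[OF W(1) K] V(2) by blast
  then have "saturation W (pullback V) = V"
    using pullback_eq_iff[OF subgroup_saturation[OF W(1) K] V(1) subset_saturation[OF W(1) K] V(2) W(2)]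
    by simp
  then show "V \<lhd> H"
    using normal_saturation[OF W N] by simp
qed (rule normal_pullback)

end

text \<open>Maximal subgroups and maximal normal subgroups are the instances where \<open>P\<close> is being a subgroup or a
  normal subgroup of a group with carrier \<open>A\<close>.\<close>

definition maximal_among :: "('a set \<Rightarrow> bool) \<Rightarrow> 'a set \<Rightarrow> 'a set \<Rightarrow> bool"
  where "maximal_among P A M \<longleftrightarrow>
    P M \<and> M \<noteq> A \<and> (\<forall>K. P K \<and> M \<subseteq> K \<and> K \<noteq> A \<longrightarrow> K = M)"

text \<open>Maximality of \<open>V\<close> involves only the subgroups with \<open>Q\<close> between \<open>V\<close> and \<open>H\<close>. These contain \<open>W\<close>, so
  the pullback is an isomorphism of ordered sets from them onto the subgroups with \<open>P\<close> between
  \<open>h\<^sup>-\<^sup>1(V)\<close> and \<open>G\<close>.\<close>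

lemma (in group_hom) maximal_iff_pullback_maximal:
  assumes W: "W \<lhd> H" "dense_modulo W" and V: "subgroup V H" "W \<subseteq> V"
    and P: "\<And>K. P K \<Longrightarrow> subgroup K G" and Q: "\<And>V. Q V \<Longrightarrow> subgroup V H"
    and PQ: "\<And>V. \<lbrakk>subgroup V H; W \<subseteq> V\<rbrakk> \<Longrightarrow> Q V \<longleftrightarrow> P (pullback V)"
  shows "maximal_among Q (carrier H) V \<longleftrightarrow> maximal_among P (carrier G) (pullback V)"
proof -
  have inj: "pullback V' = pullback V'' \<longleftrightarrow> V' = V''"
    if "subgroup V' H" "W \<subseteq> V'" "subgroup V'' H" "W \<subseteq> V''" for V' V''
    using pullback_eq_iff[OF that(1,3,2,4) W(2)] .
  have top: "pullback V' = carrier G \<longleftrightarrow> V' = carrier H" if "subgroup V' H" "W \<subseteq> V'" for V'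
  proof -
    have "pullback (carrier H) = carrier G"
      by auto
    then show ?thesis
      using inj[OF that H.subgroup_self] that subgroup.subset by blast
  qed
  have le: "pullback V \<subseteq> pullback V' \<longleftrightarrow> V \<subseteq> V'" if "subgroup V' H" "W \<subseteq> V'" for V'
    using that V W(2) subset_if_pullback_subset[of V V' W] by blast
  have ex: "\<exists>V'. subgroup V' H \<and> W \<subseteq> V' \<and> pullback V' = K"
    if "P K" "pullback V \<subseteq> K" for K
  proof -
    have "pullback W \<subseteq> K"
      using that(2) V(2) by blast
    then show ?thesis
      using P[OF that(1)] W(1) subgroup_saturation subset_saturation pullback_saturation
      by (intro exI[of _ "saturation W K"]) simp
  qed
  show ?thesis
  proof
    assume M: "maximal_among Q (carrier H) V"
    have "K = pullback V" if K: "P K" "pullback V \<subseteq> K" "K \<noteq> carrier G" for K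
    proof -
      obtain V' where V': "subgroup V' H" "W \<subseteq> V'" "pullback V' = K"
        using ex[OF K(1,2)] by blast
      have "Q V'" "V \<subseteq> V'" "V' \<noteq> carrier H"
        using K V'(3) PQ[OF V'(1,2)] le[OF V'(1,2)] top[OF V'(1,2)] by auto
      then have "V' = V"
        using M unfolding maximal_among_def by blast
      then show ?thesis
        using V'(3) by simp
    qed
    moreover have "P (pullback V)" "pullback V \<noteq> carrier G"
      using M PQ[OF V] top[OF V] by (simp_all add: maximal_among_def)
    ultimately show "maximal_among P (carrier G) (pullback V)"
      unfolding maximal_among_def by blast
  next
    assume M: "maximal_among P (carrier G) (pullback V)"
    have "V' = V" if V': "Q V'" "V \<subseteq> V'" "V' \<noteq> carrier H" for V'
    proof -
      have sub: "subgroup V' H" "W \<subseteq> V'"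
        using V' Q V(2) by auto
      have "P (pullback V')" "pullback V \<subseteq> pullback V'" "pullback V' \<noteq> carrier G"
        using V' PQ[OF sub] le[OF sub] top[OF sub] by simp_all
      then have "pullback V' = pullback V"
        using M unfolding maximal_among_def by blast
      then show ?thesis
        using inj[OF sub V] by simp
    qed
    moreover have "Q V" "V \<noteq> carrier H"
      using M PQ[OF V] top[OF V] by (simp_all add: maximal_among_def)
    ultimately show "maximal_among Q (carrier H) V"
      unfolding maximal_among_def by blast
  qed
qed

section \<open>Intersection indices in a group and in a completion of it\<close>

text \<open>The properties of a profinite completion \<open>h : G \<rightarrow> H\<close> on which the comparison of index functions rests.
  The family \<open>\<W>\<close> stands for a neighbourhood base at \<open>\<one>\<close> made of open normal subgroups: a subgroup of
  finite index is closed exactly if it contains a member of \<open>\<W>\<close>. The condition \<open>cofinal\<close> says that every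
  subgroup of finite index in \<open>G\<close> is open in the topology induced along \<open>h\<close>.\<close>

locale dense_completion = group_hom G H h for G (structure) and H (structure) and h +
  fixes \<W> :: "'c set set" and T :: "'c topology"
  assumes normal: "W \<in> \<W> \<Longrightarrow> W \<lhd> H"
    and dense: "W \<in> \<W> \<Longrightarrow> dense_modulo W"
    and directed: "\<lbrakk>W \<in> \<W>; W' \<in> \<W>\<rbrakk> \<Longrightarrow> \<exists>W'' \<in> \<W>. W'' \<subseteq> W \<inter> W'"
    and cofinal: "\<lbrakk>subgroup K G; finite (rcosets K)\<rbrakk> \<Longrightarrow> \<exists>W \<in> \<W>. pullback W \<subseteq> K"
    and closed_imp_contains: "\<lbrakk>subgroup V H; closedin T V; finite (rcosets\<^bsub>H\<^esub> V)\<rbrakk> \<Longrightarrow> \<exists>W \<in> \<W>. W \<subseteq> V"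
    and contains_imp_closed: "\<lbrakk>subgroup V H; W \<in> \<W>; W \<subseteq> V\<rbrakk> \<Longrightarrow> closedin T V"

lemma finite_rcosets_if_index_le: "subgroup_index G K \<le> enat n \<Longrightarrow> finite (rcosets\<^bsub>G\<^esub> K)"
  by (auto simp: subgroup_index_def split: if_splits)

lemma (in group) subgroup_carrier_Int_Inter:
  assumes "\<And>K. K \<in> \<F> \<Longrightarrow> subgroup K G"
  shows "subgroup (carrier G \<inter> \<Inter>\<F>) G"
proof -
  have "subgroup (\<Inter>(insert (carrier G) \<F>)) G"
    using assms subgroup_self by (intro subgroups_Inter) auto
  then show ?thesis
    by simp
qed

text \<open>Let \<open>K\<close> and \<open>V\<close> be the two intersections. The members of the two families match under the pullback,
  so \<open>K = h\<^sup>-\<^sup>1(V)\<close>. An infinite index of \<open>K\<close> forces an infinite index of \<open>V\<close>, since the coset map is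
  injective. If \<open>K\<close> has finite index, it contains the pullback of some \<open>W\<close>; then \<open>W\<close> lies in every member
  of the second family, hence in \<open>V\<close>, so that \<open>h\<close> is dense modulo \<open>V\<close> and the coset map is bijective.\<close>

theorem (in dense_completion) intersection_index_eq:
  assumes P: "\<And>K. P K \<Longrightarrow> subgroup K G" and Q: "\<And>V. Q V \<Longrightarrow> subgroup V H"
    and PQ: "\<And>W V. \<lbrakk>W \<in> \<W>; subgroup V H; W \<subseteq> V\<rbrakk> \<Longrightarrow> Q V \<longleftrightarrow> P (pullback V)"
  shows "intersection_index G P n = intersection_index H (\<lambda>V. Q V \<and> closedin T V) n"
proof -
  define \<F> where "\<F> = {K. P K \<and> subgroup_index G K \<le> enat n}"
  define \<F>' where "\<F>' = {V. (Q V \<and> closedin T V) \<and> subgroup_index H V \<le> enat n}"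
  define K where "K = carrier G \<inter> \<Inter>\<F>"
  define V where "V = carrier H \<inter> \<Inter>\<F>'"
  have K_sub: "subgroup K G"
    unfolding K_def using P by (intro G.subgroup_carrier_Int_Inter) (simp add: \<F>_def)
  have V_sub: "subgroup V H"
    unfolding V_def using Q by (intro H.subgroup_carrier_Int_Inter) (simp add: \<F>'_def)
  have down: "(\<exists>W \<in> \<W>. W \<subseteq> V') \<and> pullback V' \<in> \<F>" if "V' \<in> \<F>'" for V'
  proof -
    have V': "Q V'" "closedin T V'" "subgroup V' H" "subgroup_index H V' \<le> enat n"
      using that Q by (auto simp: \<F>'_def)
    then obtain W where "W \<in> \<W>" "W \<subseteq> V'"
      using closed_imp_contains finite_rcosets_if_index_le by blast
    then show ?thesis
      using V' PQ index_pullback dense_modulo_mono[OF dense] by (auto simp: \<F>_def)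
  qed
  have up: "\<exists>V' \<in> \<F>'. pullback V' = K'" if "K' \<in> \<F>" for K'
  proof -
    have K': "P K'" "subgroup K' G" "subgroup_index G K' \<le> enat n"
      using that P by (auto simp: \<F>_def)
    then obtain W where W: "W \<in> \<W>" "pullback W \<subseteq> K'"
      using cofinal finite_rcosets_if_index_le by blast
    define V' where "V' = saturation W K'"
    have V': "subgroup V' H" "W \<subseteq> V'" "pullback V' = K'"
      unfolding V'_def using normal[OF W(1)] K'(2) W(2)
      by (simp_all add: subgroup_saturation subset_saturation pullback_saturation)
    have "subgroup_index H V' = subgroup_index G K'"
      using index_pullback[OF V'(1)] dense_modulo_mono[OF dense[OF W(1)]] V' by simp
    then have "V' \<in> \<F>'"
      using K' V' PQ[OF W(1) V'(1,2)] contains_imp_closed[OF V'(1) W(1)] by (simp add: \<F>'_def)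
    then show ?thesis
      using V'(3) by blast
  qed
  have pb: "pullback V = K"
  proof
    show "pullback V \<subseteq> K"
      using up by (fastforce simp: V_def K_def)
    show "K \<subseteq> pullback V"
      using down by (auto simp: V_def K_def)
  qed
  have "subgroup_index G K = subgroup_index H V"
  proof (cases "finite (rcosets K)")
    case True
    then obtain W where W: "W \<in> \<W>" "pullback W \<subseteq> K"
      using cofinal K_sub by blast
    have "W \<subseteq> V'" if "V' \<in> \<F>'" for V'
    proof -
      have V': "subgroup V' H"
        using that Q by (auto simp: \<F>'_def)
      \<comment> \<open>The member of \<open>\<W>\<close> inside \<open>V'\<close> depends on \<open>V'\<close>; below both it and \<open>W\<close> the inclusion \<open>W \<subseteq> V'\<close> can be
        tested on pullbacks.\<close>
      obtain W' where "W' \<in> \<W>" "W' \<subseteq> V'"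
        using down[OF \<open>V' \<in> \<F>'\<close>] by blast
      then obtain W'' where W'': "W'' \<in> \<W>" "W'' \<subseteq> W" "W'' \<subseteq> V'"
        using directed W(1) by blast
      have "pullback W \<subseteq> pullback V'"
        using W(2) down[OF \<open>V' \<in> \<F>'\<close>] by (auto simp: K_def)
      then show ?thesis
        using subset_if_pullback_subset[OF normal_imp_subgroup[OF normal[OF W(1)]] V' W''(2,3)
            dense[OF W''(1)]] by blast
    qed
    then have "W \<subseteq> V"
      using normal[OF W(1)] by (auto simp: V_def dest: normal_imp_subgroup subgroup.subset)
    then show ?thesis
      using index_pullback[OF V_sub] dense_modulo_mono[OF dense[OF W(1)]] pb by simp
  next
    case False
    then have "infinite (rcosets\<^bsub>H\<^esub> V)"
      using finite_rcosets_pullback[OF V_sub] pb by auto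
    then show ?thesis
      using False by (simp add: subgroup_index_def)
  qed
  then show ?thesis
    by (simp add: intersection_index_def K_def V_def \<F>_def \<F>'_def)
qed

section \<open>The profinite completion\<close>

context group
begin

abbreviation completion :: "('a set \<Rightarrow> 'a set) monoid"
  where "completion \<equiv> profinite_completion G"

lemma subgroup_finite_index_normal: "N \<in> finite_index_normal G \<Longrightarrow> subgroup N G"
  by (simp add: finite_index_normal_def normal_imp_subgroup)

lemma normal_finite_index_normal: "N \<in> finite_index_normal G \<Longrightarrow> N \<lhd> G"
  by (simp add: finite_index_normal_def)

lemma set_mult_rcos_absorb:
  assumes "subgroup M G" "N \<subseteq> M" "\<one> \<in> N" "a \<in> carrier G"
  shows "M <#> (N #> a) = M #> a"
proof -
  have "N \<subseteq> carrier G"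
    using assms(1,2) subgroup.subset by blast
  moreover have "M <#> N = M"
  proof
    show "M <#> N \<subseteq> M"
      using assms(1,2) by (auto simp: set_mult_def subgroup.m_closed)
    show "M \<subseteq> M <#> N"
    proof
      fix x assume "x \<in> M"
      then have "x \<otimes> \<one> \<in> M <#> N"
        using assms(3) unfolding set_mult_def by blast
      then show "x \<in> M <#> N"
        using \<open>x \<in> M\<close> assms(1) by (simp add: subgroup.mem_carrier)
    qed
  qed
  ultimately show ?thesis
    using assms(1,4) by (simp add: setmult_rcos_assoc subgroup.subset)
qed

lemma carrier_completion:
  "carrier completion = {f \<in> (\<Pi>\<^sub>E N \<in> finite_index_normal G. carrier (G Mod N)).
     \<forall>N \<in> finite_index_normal G. \<forall>M \<in> finite_index_normal G. N \<subseteq> M \<longrightarrow> f M = M <#> f N}"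
proof -
  have "carrier (R\<lparr>carrier := X\<rparr>) = X" for R :: "('x, 'y) monoid_scheme" and X
    by simp
  then show ?thesis
    unfolding profinite_completion_def .
qed

text \<open>Compatibility in terms of representatives: for each \<open>N\<close> a single element of \<open>G\<close> represents all
  coordinates of \<open>f\<close> at subgroups above \<open>N\<close>. Group operations on \<open>f\<close> can then be carried out on
  representatives.\<close>

lemma mem_completion_iff:
  "f \<in> carrier completion \<longleftrightarrow> f \<in> extensional (finite_index_normal G) \<and>
     (\<forall>N \<in> finite_index_normal G. \<exists>a \<in> carrier G.
        \<forall>M \<in> finite_index_normal G. N \<subseteq> M \<longrightarrow> f M = M #> a)"
  (is "?L \<longleftrightarrow> ?R")
proof
  assume ?L
  then have L: "f \<in> (\<Pi>\<^sub>E N\<in>finite_index_normal G. carrier (G Mod N))"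
    and compat: "\<And>N M. \<lbrakk>N \<in> finite_index_normal G; M \<in> finite_index_normal G; N \<subseteq> M\<rbrakk> \<Longrightarrow> f M = M <#> f N"
    unfolding carrier_completion by blast+
  have "\<exists>a \<in> carrier G. \<forall>M \<in> finite_index_normal G. N \<subseteq> M \<longrightarrow> f M = M #> a"
    if N: "N \<in> finite_index_normal G" for N
  proof -
    obtain a where a: "a \<in> carrier G" "f N = N #> a"
      using PiE_mem[OF L N] by (auto simp: carrier_FactGroup)
    have "f M = M #> a" if M: "M \<in> finite_index_normal G" "N \<subseteq> M" for M
    proof -
      have "f M = M <#> f N"
        using compat N M by blast
      then show ?thesis
        using a set_mult_rcos_absorb[OF subgroup_finite_index_normal[OF M(1)] M(2)]
          subgroup.one_closed[OF subgroup_finite_index_normal[OF N]] by simp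
    qed
    then show ?thesis
      using a(1) by blast
  qed
  then show ?R
    using L by (simp add: PiE_iff)
next
  assume R: ?R
  have "f N \<in> carrier (G Mod N)" if "N \<in> finite_index_normal G" for N
    using R that by (auto simp: carrier_FactGroup)
  moreover have "f M = M <#> f N"
    if N: "N \<in> finite_index_normal G" and M: "M \<in> finite_index_normal G" "N \<subseteq> M" for M N
  proof -
    obtain a where "a \<in> carrier G" "\<forall>M \<in> finite_index_normal G. N \<subseteq> M \<longrightarrow> f M = M #> a"
      using bspec[OF conjunct2[OF R] N] by blast
    then have "a \<in> carrier G" "f N = N #> a" "f M = M #> a"
      using N M by blast+
    then show ?thesis
      using set_mult_rcos_absorb[OF subgroup_finite_index_normal[OF M(1)] M(2)]
          subgroup.one_closed[OF subgroup_finite_index_normal[OF N]] by simp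
  qed
  ultimately show ?L
    using conjunct1[OF R] unfolding carrier_completion PiE_iff by blast
qed

lemma completion_representative:
  assumes "f \<in> carrier completion" "N \<in> finite_index_normal G"
  obtains a where "a \<in> carrier G"
    "\<And>M. \<lbrakk>M \<in> finite_index_normal G; N \<subseteq> M\<rbrakk> \<Longrightarrow> f M = M #> a"
  using assms unfolding mem_completion_iff by metis

lemma completion_mult: "f \<otimes>\<^bsub>completion\<^esub> f' = (\<lambda>N\<in>finite_index_normal G. f N <#> f' N)"
  by (simp add: profinite_completion_def product_group_def)

lemma completion_one: "\<one>\<^bsub>completion\<^esub> = (\<lambda>N\<in>finite_index_normal G. N)"
  by (simp add: profinite_completion_def product_group_def)

lemma group_completion: "group completion"
proof -
  let ?I = "finite_index_normal G"
  let ?P = "product_group ?I (\<lambda>N. G Mod N)"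
  have GM: "group (G Mod N)" if "N \<in> ?I" for N
    using that by (simp add: normal.factorgroup_is_group normal_finite_index_normal)
  interpret P: group ?P
    by (intro product_group GM)
  have sub: "carrier completion \<subseteq> carrier ?P"
    unfolding carrier_completion by auto
  have "subgroup (carrier completion) ?P"
  proof (rule P.subgroupI[OF sub])
    have "(\<lambda>N\<in>?I. N) \<in> carrier completion"
      unfolding mem_completion_iff
      by (auto intro!: bexI[of _ \<one>] simp: subgroup.subset subgroup_finite_index_normal)
    then show "carrier completion \<noteq> {}"
      by blast
  next
    fix f assume f: "f \<in> carrier completion"
    have "\<exists>a \<in> carrier G. \<forall>M \<in> ?I. N \<subseteq> M \<longrightarrow> inv\<^bsub>G Mod M\<^esub> f M = M #> a" if N: "N \<in> ?I" for N
    proof -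
      obtain a where a: "a \<in> carrier G" "\<And>M. \<lbrakk>M \<in> ?I; N \<subseteq> M\<rbrakk> \<Longrightarrow> f M = M #> a"
        using completion_representative[OF f N] by blast
      have "inv\<^bsub>G Mod M\<^esub> f M = M #> inv a" if "M \<in> ?I" "N \<subseteq> M" for M
        using a that normal.inv_FactGroup[OF normal_finite_index_normal[OF that(1)], of "f M"]
          normal.rcos_inv[OF normal_finite_index_normal[OF that(1)] a(1)]
        by (auto simp: carrier_FactGroup)
      then show ?thesis
        using a(1) by blast
    qed
    moreover have "inv\<^bsub>?P\<^esub> f = (\<lambda>N\<in>?I. inv\<^bsub>G Mod N\<^esub> f N)"
      using f sub GM by (intro inv_product_group) auto
    ultimately show "inv\<^bsub>?P\<^esub> f \<in> carrier completion"
      by (simp add: mem_completion_iff cong: ball_cong)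
  next
    fix f f' assume f: "f \<in> carrier completion" and f': "f' \<in> carrier completion"
    have "\<exists>a \<in> carrier G. \<forall>M \<in> ?I. N \<subseteq> M \<longrightarrow> f M <#> f' M = M #> a" if N: "N \<in> ?I" for N
    proof -
      obtain a where a: "a \<in> carrier G" "\<And>M. \<lbrakk>M \<in> ?I; N \<subseteq> M\<rbrakk> \<Longrightarrow> f M = M #> a"
        using completion_representative[OF f N] by blast
      obtain a' where a': "a' \<in> carrier G" "\<And>M. \<lbrakk>M \<in> ?I; N \<subseteq> M\<rbrakk> \<Longrightarrow> f' M = M #> a'"
        using completion_representative[OF f' N] by blast
      have "f M <#> f' M = M #> (a \<otimes> a')" if "M \<in> ?I" "N \<subseteq> M" for M
        using that a a' normal.rcos_sum[OF normal_finite_index_normal] by simp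
      then show ?thesis
        using a(1) a'(1) by blast
    qed
    then show "f \<otimes>\<^bsub>?P\<^esub> f' \<in> carrier completion"
      by (simp add: mem_completion_iff)
  qed
  then have "group (?P\<lparr>carrier := carrier completion\<rparr>)"
    using subgroup.subgroup_is_group P.group_axioms by blast
  moreover have "?P\<lparr>carrier := carrier completion\<rparr> = completion"
    by (simp add: profinite_completion_def)
  ultimately show ?thesis
    by simp
qed

definition to_completion :: "'a \<Rightarrow> 'a set \<Rightarrow> 'a set"
  where "to_completion a = (\<lambda>N\<in>finite_index_normal G. N #> a)"

lemma group_hom_to_completion: "group_hom G completion to_completion"
proof (intro group_hom.intro group_hom_axioms.intro group_axioms group_completion homI)
  show "to_completion a \<in> carrier completion" if "a \<in> carrier G" for a
    using that by (auto simp: mem_completion_iff to_completion_def)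
  show "to_completion (a \<otimes> b) = to_completion a \<otimes>\<^bsub>completion\<^esub> to_completion b"
    if "a \<in> carrier G" "b \<in> carrier G" for a b
    using that by (auto simp: to_completion_def completion_mult normal.rcos_sum
        normal_finite_index_normal intro!: restrict_ext)
qed

lemma group_hom_projection:
  assumes N: "N \<in> finite_index_normal G"
  shows "group_hom completion (G Mod N) (\<lambda>f. f N)"
proof (intro group_hom.intro group_hom_axioms.intro group_completion homI)
  show "group (G Mod N)"
    using N by (simp add: normal.factorgroup_is_group normal_finite_index_normal)
  show "f N \<in> carrier (G Mod N)" if "f \<in> carrier completion" for f
  proof -
    have "f \<in> (\<Pi>\<^sub>E N \<in> finite_index_normal G. carrier (G Mod N))"
      using that unfolding carrier_completion by simp
    then show ?thesis
      using N by (rule PiE_mem)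
  qed
qed (simp add: N completion_mult)

text \<open>As \<open>N\<close> varies, the kernels of the coordinate projections form a base of neighbourhoods of \<open>\<one>\<close>.\<close>

definition congruence_kernel :: "'a set \<Rightarrow> ('a set \<Rightarrow> 'a set) set"
  where "congruence_kernel N = kernel completion (G Mod N) (\<lambda>f. f N)"

lemma mem_congruence_kernel: "f \<in> congruence_kernel N \<longleftrightarrow> f \<in> carrier completion \<and> f N = N"
  by (simp add: congruence_kernel_def kernel_def)

lemma normal_congruence_kernel:
  "N \<in> finite_index_normal G \<Longrightarrow> congruence_kernel N \<lhd> completion"
  unfolding congruence_kernel_def by (rule group_hom.normal_kernel[OF group_hom_projection])

lemma congruence_kernel_mono:
  assumes "M \<in> finite_index_normal G" "N \<in> finite_index_normal G" "M \<subseteq> N"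
  shows "congruence_kernel M \<subseteq> congruence_kernel N"
proof
  fix f assume "f \<in> congruence_kernel M"
  then have f: "f \<in> carrier completion" "f M = M"
    by (auto simp: mem_congruence_kernel)
  then obtain a where a: "a \<in> carrier G" "f M = M #> a" "f N = N #> a"
    using completion_representative[of f M] assms by (metis subset_refl)
  then have "a \<in> N"
    using f(2) assms coset_join1[OF _ a(1) subgroup_finite_index_normal] by auto
  then show "f \<in> congruence_kernel N"
    using f(1) a assms by (simp add: mem_congruence_kernel coset_join2 subgroup_finite_index_normal)
qed

lemma quotient_mem_congruence_kernel_iff:
  assumes N: "N \<in> finite_index_normal G" and f: "f \<in> carrier completion" and f': "f' \<in> carrier completion"
  shows "f \<otimes>\<^bsub>completion\<^esub> inv\<^bsub>completion\<^esub> f' \<in> congruence_kernel N \<longleftrightarrow> f N = f' N"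
proof -
  interpret p: group_hom completion "G Mod N" "\<lambda>f. f N"
    using group_hom_projection[OF N] .
  have "(f \<otimes>\<^bsub>completion\<^esub> inv\<^bsub>completion\<^esub> f') N = f N \<otimes>\<^bsub>G Mod N\<^esub> inv\<^bsub>G Mod N\<^esub> f' N"
    using f f' p.hom_mult p.hom_inv by (metis p.G.inv_closed)
  moreover have "f N \<otimes>\<^bsub>G Mod N\<^esub> inv\<^bsub>G Mod N\<^esub> f' N = \<one>\<^bsub>G Mod N\<^esub> \<longleftrightarrow> f N = f' N"
    using f f' p.hom_closed by (metis p.H.inv_solve_right p.H.l_one p.H.one_closed)
  ultimately show ?thesis
    using f f' by (simp add: mem_congruence_kernel)
qed

lemma vimage_congruence_kernel:
  assumes N: "N \<in> finite_index_normal G"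
  shows "to_completion -` congruence_kernel N \<inter> carrier G = N"
proof -
  have "to_completion a \<in> carrier completion" if "a \<in> carrier G" for a
    using that group_hom.hom_closed[OF group_hom_to_completion] by blast
  moreover have "N #> a = N \<longleftrightarrow> a \<in> N" if "a \<in> carrier G" for a
    using that coset_join1 coset_join2 subgroup_finite_index_normal[OF N] by blast
  ultimately show ?thesis
    using N subgroup.subset[OF subgroup_finite_index_normal[OF N]]
    by (auto simp: mem_congruence_kernel to_completion_def)
qed

lemma dense_modulo_congruence_kernel:
  assumes N: "N \<in> finite_index_normal G"
  shows "group_hom.dense_modulo G completion to_completion (congruence_kernel N)"
proof -
  interpret c: group_hom G completion to_completion
    by (rule group_hom_to_completion)
  show ?thesis
    unfolding c.dense_modulo_def
  proof
    fix f assume f: "f \<in> carrier completion"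
    obtain a where a: "a \<in> carrier G"
      and rep: "\<And>M. \<lbrakk>M \<in> finite_index_normal G; N \<subseteq> M\<rbrakk> \<Longrightarrow> f M = M #> a"
      using completion_representative[OF f N] by blast
    have "f N = to_completion a N"
      using rep[OF N order_refl] N by (simp add: to_completion_def)
    then have "f \<otimes>\<^bsub>completion\<^esub> inv\<^bsub>completion\<^esub> to_completion a \<in> congruence_kernel N"
      using quotient_mem_congruence_kernel_iff[OF N f c.hom_closed[OF a]] by simp
    then show "\<exists>a \<in> carrier G. f \<otimes>\<^bsub>completion\<^esub> inv\<^bsub>completion\<^esub> to_completion a \<in> congruence_kernel N"
      using a by blast
  qed
qed

section \<open>Closed subgroups of finite index in the profinite completion\<close>

lemma topspace_profinite_topology: "topspace (profinite_topology G) = carrier completion"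
  unfolding profinite_topology_def carrier_completion by auto

lemma continuous_projection:
  assumes "N \<in> finite_index_normal G"
  shows "continuous_map (profinite_topology G) (discrete_topology (carrier (G Mod N))) (\<lambda>f. f N)"
  unfolding profinite_topology_def
  using assms by (intro continuous_map_from_subtopology continuous_map_product_projection)

text \<open>Membership in \<open>V\<close> depends only on the coordinate at \<open>N\<close>, which varies continuously in a discrete space.\<close>

lemma closedin_if_contains_congruence_kernel:
  assumes V: "subgroup V completion" and N: "N \<in> finite_index_normal G" and sub: "congruence_kernel N \<subseteq> V"
  shows "closedin (profinite_topology G) V"
proof -
  interpret C: group completion
    by (rule group_completion)
  interpret p: group_hom completion "G Mod N" "\<lambda>f. f N"
    using group_hom_projection[OF N] .
  have Vc: "V \<subseteq> carrier completion"
    using V subgroup.subset by blast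
  have "f \<in> V" if f: "f \<in> carrier completion" and v: "v \<in> V" "f N = v N" for f v
  proof -
    have "f \<otimes>\<^bsub>completion\<^esub> inv\<^bsub>completion\<^esub> v \<in> V"
      using quotient_mem_congruence_kernel_iff[OF N f] v Vc sub by blast
    then show ?thesis
      using C.rcos_eq_iff[OF V f] C.coset_join1[OF _ f V] C.coset_join2[OF _ V v(1)] v Vc by blast
  qed
  then have V_eq: "V = {f \<in> topspace (profinite_topology G). f N \<in> (\<lambda>f. f N) ` V}"
    using Vc by (auto simp: topspace_profinite_topology)
  have cl: "closedin (discrete_topology (carrier (G Mod N))) ((\<lambda>f. f N) ` V)"
    using Vc by auto
  show ?thesis
    by (subst V_eq) (rule closedin_continuous_map_preimage[OF continuous_projection[OF N] cl])
qed

lemma continuous_right_translation: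
  assumes a: "a \<in> carrier completion"
  shows "continuous_map (profinite_topology G) (profinite_topology G) (\<lambda>f. f \<otimes>\<^bsub>completion\<^esub> a)"
proof -
  interpret C: group completion
    by (rule group_completion)
  have "continuous_map (profinite_topology G) (discrete_topology (carrier (G Mod N)))
      (\<lambda>f. (f \<otimes>\<^bsub>completion\<^esub> a) N)" if N: "N \<in> finite_index_normal G" for N
  proof -
    interpret p: group_hom completion "G Mod N" "\<lambda>f. f N"
      using group_hom_projection[OF N] .
    have "continuous_map (discrete_topology (carrier (G Mod N))) (discrete_topology (carrier (G Mod N)))
        (\<lambda>c. c \<otimes>\<^bsub>G Mod N\<^esub> a N)"
      using a p.H.m_closed p.hom_closed by auto
    then have "continuous_map (profinite_topology G) (discrete_topology (carrier (G Mod N)))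
        ((\<lambda>c. c \<otimes>\<^bsub>G Mod N\<^esub> a N) \<circ> (\<lambda>f. f N))"
      using continuous_map_compose[OF continuous_projection[OF N]] by blast
    then show ?thesis
      using N by (simp add: o_def completion_mult)
  qed
  moreover have "(\<lambda>f. f \<otimes>\<^bsub>completion\<^esub> a) \<in> topspace (profinite_topology G) \<rightarrow> carrier completion"
    using a by (auto simp: topspace_profinite_topology)
  moreover have "(\<lambda>f. f \<otimes>\<^bsub>completion\<^esub> a) \<in> topspace (profinite_topology G) \<rightarrow> extensional (finite_index_normal G)"
    by (auto simp: completion_mult)
  ultimately have "continuous_map (profinite_topology G)
      (subtopology
        (product_topology (\<lambda>N. discrete_topology (carrier (G Mod N))) (finite_index_normal G))
        (carrier completion)) (\<lambda>f. f \<otimes>\<^bsub>completion\<^esub> a)"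
    by (auto simp: continuous_map_in_subtopology continuous_map_componentwise)
  then show ?thesis
    by (simp flip: profinite_topology_def)
qed

text \<open>The complement is the union of the other cosets. There are finitely many, and each is closed because
  translations are continuous.\<close>

lemma openin_if_closedin_finite_index:
  assumes V: "subgroup V completion" and cl: "closedin (profinite_topology G) V"
    and fin: "finite (rcosets\<^bsub>completion\<^esub> V)"
  shows "openin (profinite_topology G) V"
proof -
  interpret C: group completion
    by (rule group_completion)
  have coset: "closedin (profinite_topology G) (V #>\<^bsub>completion\<^esub> a)" if a: "a \<in> carrier completion" for a
  proof -
    have "V #>\<^bsub>completion\<^esub> a = {f \<in> topspace (profinite_topology G). f \<otimes>\<^bsub>completion\<^esub> inv\<^bsub>completion\<^esub> a \<in> V}"
    proof (intro equalityI subsetI)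
      fix f assume "f \<in> V #>\<^bsub>completion\<^esub> a"
      then show "f \<in> {f \<in> topspace (profinite_topology G). f \<otimes>\<^bsub>completion\<^esub> inv\<^bsub>completion\<^esub> a \<in> V}"
        using a V C.m_assoc subgroup.mem_carrier[OF V]
        by (auto simp: r_coset_def topspace_profinite_topology)
    next
      fix f assume "f \<in> {f \<in> topspace (profinite_topology G). f \<otimes>\<^bsub>completion\<^esub> inv\<^bsub>completion\<^esub> a \<in> V}"
      then show "f \<in> V #>\<^bsub>completion\<^esub> a"
        using a C.rcos_eq_iff[OF V] C.rcos_self[OF _ V] by (auto simp: topspace_profinite_topology)
    qed
    then show ?thesis
      using closedin_continuous_map_preimage[OF continuous_right_translation cl] a by simp
  qed
  have "closedin (profinite_topology G) (\<Union>(rcosets\<^bsub>completion\<^esub> V - {V}))"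
    using fin coset by (intro closedin_Union) (auto simp: RCOSETS_def)
  moreover have "\<Union>(rcosets\<^bsub>completion\<^esub> V - {V}) = carrier completion - V"
  proof -
    have "V \<in> rcosets\<^bsub>completion\<^esub> V"
      using V subgroup.subgroup_in_rcosets C.group_axioms by blast
    then have "X \<inter> V = {}" if "X \<in> rcosets\<^bsub>completion\<^esub> V" "X \<noteq> V" for X
      using C.rcos_disjoint[OF V] that by (auto simp: pairwise_def disjnt_def)
    then show ?thesis
      using C.rcosets_part_G[OF V] by blast
  qed
  ultimately show ?thesis
    using V by (simp add: openin_closedin_eq topspace_profinite_topology subgroup.subset)
qed

text \<open>A basic neighbourhood of \<open>\<one>\<close> inside \<open>V\<close> restricts only finitely many coordinates. An element that is
  trivial at the intersection \<open>N\<close> of their indices is trivial at each of them.\<close>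

lemma contains_congruence_kernel_if_openin:
  assumes V: "subgroup V completion" and op: "openin (profinite_topology G) V"
  shows "\<exists>N \<in> finite_index_normal G. congruence_kernel N \<subseteq> V"
proof -
  let ?I = "finite_index_normal G"
  obtain S where S: "openin (product_topology (\<lambda>N. discrete_topology (carrier (G Mod N))) ?I) S"
    and VS: "V = S \<inter> carrier completion"
    using op by (auto simp: profinite_topology_def openin_subtopology)
  have "\<one>\<^bsub>completion\<^esub> \<in> S"
    using subgroup.one_closed[OF V] VS by blast
  then obtain U where fin: "finite {i \<in> ?I. U i \<noteq> carrier (G Mod i)}"
    and one: "\<one>\<^bsub>completion\<^esub> \<in> Pi\<^sub>E ?I U" and US: "Pi\<^sub>E ?I U \<subseteq> S"
    using S unfolding openin_product_topology_alt
    by (metis (no_types, lifting) Collect_cong topspace_discrete_topology)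
  define J where "J = {i \<in> ?I. U i \<noteq> carrier (G Mod i)}"
  \<comment> \<open>\<open>J\<close> may be empty, and then \<open>N = G\<close>.\<close>
  define N where "N = carrier G \<inter> \<Inter>J"
  have N: "N \<in> ?I"
    unfolding N_def using fin by (intro finite_index_normal_Inter) (auto simp: J_def)
  have "f \<in> V" if f: "f \<in> congruence_kernel N" for f
  proof -
    have fc: "f \<in> carrier completion"
      using f by (simp add: mem_congruence_kernel)
    have "f i \<in> U i" if i: "i \<in> ?I" for i
    proof (cases "i \<in> J")
      case True
      then have "N \<subseteq> i"
        by (auto simp: N_def)
      then have "f i = i"
        using congruence_kernel_mono[OF N i] f by (auto simp: mem_congruence_kernel)
      then show ?thesis
        using one i by (auto simp: completion_one PiE_iff)
    next
      case False
      then show ?thesis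
        using group_hom.hom_closed[OF group_hom_projection[OF i] fc] i by (simp add: J_def)
    qed
    then have "f \<in> Pi\<^sub>E ?I U"
      using fc by (auto simp: mem_completion_iff PiE_iff)
    then show ?thesis
      using US VS fc by blast
  qed
  then show ?thesis
    using N by blast
qed

lemma dense_completion_profinite_completion:
  "dense_completion G completion to_completion (congruence_kernel ` finite_index_normal G)
     (profinite_topology G)"
proof -
  interpret c: group_hom G completion to_completion
    by (rule group_hom_to_completion)
  show ?thesis
  proof (intro dense_completion.intro[OF c.group_hom_axioms] dense_completion_axioms.intro)
    show "W \<lhd> completion" if "W \<in> congruence_kernel ` finite_index_normal G" for W
      using that normal_congruence_kernel by blast
    show "c.dense_modulo W" if "W \<in> congruence_kernel ` finite_index_normal G" for W
      using that dense_modulo_congruence_kernel by blast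
    show "\<exists>W''\<in>congruence_kernel ` finite_index_normal G. W'' \<subseteq> W \<inter> W'"
      if W: "W \<in> congruence_kernel ` finite_index_normal G"
        "W' \<in> congruence_kernel ` finite_index_normal G" for W W'
    proof -
      obtain M N where "M \<in> finite_index_normal G" "N \<in> finite_index_normal G"
        "W = congruence_kernel M" "W' = congruence_kernel N"
        using W by blast
      then show ?thesis
        using finite_index_normal_Int congruence_kernel_mono
        by (metis Int_greatest Int_lower1 Int_lower2 image_eqI)
    qed
    show "\<exists>W\<in>congruence_kernel ` finite_index_normal G. c.pullback W \<subseteq> K"
      if K: "subgroup K G" "finite (rcosets K)" for K
    proof -
      obtain N where N: "N \<in> finite_index_normal G" "N \<subseteq> K"
        using finite_index_contains_normal[OF K] by (auto simp: finite_index_normal_def)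
      show ?thesis
        using N by (intro bexI[of _ "congruence_kernel N"]) (simp_all add: vimage_congruence_kernel)
    qed
    show "\<exists>W\<in>congruence_kernel ` finite_index_normal G. W \<subseteq> V"
      if "subgroup V completion" "closedin (profinite_topology G) V" "finite (rcosets\<^bsub>completion\<^esub> V)" for V
      using contains_congruence_kernel_if_openin[OF that(1) openin_if_closedin_finite_index[OF that]]
      by blast
    show "closedin (profinite_topology G) V"
      if "subgroup V completion" "W \<in> congruence_kernel ` finite_index_normal G" "W \<subseteq> V" for V W
      using that(2,3) closedin_if_contains_congruence_kernel[OF that(1)] by auto
  qed
qed

end

theorem lemma4p1:
  fixes \<Gamma> :: "('a, 'b) monoid_scheme" and n :: nat
  assumes "finitely_generated_group \<Gamma>" and "n > 0"
  shows "i_sub \<Gamma> n = i_sub_closed (profinite_completion \<Gamma>) (profinite_topology \<Gamma>) n \<and>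
         i_normal \<Gamma> n = i_normal_closed (profinite_completion \<Gamma>) (profinite_topology \<Gamma>) n \<and>
         i_max \<Gamma> n = i_max_closed (profinite_completion \<Gamma>) (profinite_topology \<Gamma>) n \<and>
         i_max_normal \<Gamma> n = i_max_normal_closed (profinite_completion \<Gamma>) (profinite_topology \<Gamma>) n"
proof -
  interpret group \<Gamma>
    using assms(1) by (simp add: finitely_generated_group_def)
  interpret c: dense_completion \<Gamma> "profinite_completion \<Gamma>" to_completion
      "congruence_kernel ` finite_index_normal \<Gamma>" "profinite_topology \<Gamma>"
    by (rule dense_completion_profinite_completion)
  have max: "maximal_subgroup M G \<longleftrightarrow> maximal_among (\<lambda>K. subgroup K G) (carrier G) M"
    "maximal_normal_subgroup M G \<longleftrightarrow> maximal_among (\<lambda>K. K \<lhd> G) (carrier G) M"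
    for M and G :: "('x, 'y) monoid_scheme"
    by (simp_all add: maximal_subgroup_def maximal_normal_subgroup_def maximal_among_def)
  have "i_sub \<Gamma> n = i_sub_closed (profinite_completion \<Gamma>) (profinite_topology \<Gamma>) n"
    unfolding i_sub_def i_sub_closed_def
    by (rule c.intersection_index_eq) (simp_all add: c.subgroup_pullback)
  moreover have "i_normal \<Gamma> n = i_normal_closed (profinite_completion \<Gamma>) (profinite_topology \<Gamma>) n"
    unfolding i_normal_def i_normal_closed_def
    by (rule c.intersection_index_eq)
      (auto intro: normal_imp_subgroup simp: c.normal_iff_pullback_normal[OF c.normal c.dense])
  moreover have "i_max \<Gamma> n = i_max_closed (profinite_completion \<Gamma>) (profinite_topology \<Gamma>) n"
    unfolding i_max_def i_max_closed_def max
  proof (rule c.intersection_index_eq)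
    show "maximal_among (\<lambda>K. subgroup K (profinite_completion \<Gamma>)) (carrier (profinite_completion \<Gamma>)) V
        \<longleftrightarrow> maximal_among (\<lambda>K. subgroup K \<Gamma>) (carrier \<Gamma>) (c.pullback V)"
      if "W \<in> congruence_kernel ` finite_index_normal \<Gamma>" "subgroup V (profinite_completion \<Gamma>)" "W \<subseteq> V"
      for W V
      by (rule c.maximal_iff_pullback_maximal[OF c.normal[OF that(1)] c.dense[OF that(1)] that(2,3)])
        (simp_all add: c.subgroup_pullback)
  qed (simp_all add: maximal_among_def)
  moreover have "i_max_normal \<Gamma> n = i_max_normal_closed (profinite_completion \<Gamma>) (profinite_topology \<Gamma>) n"
    unfolding i_max_normal_def i_max_normal_closed_def max
  proof (rule c.intersection_index_eq)
    show "maximal_among (\<lambda>K. K \<lhd> profinite_completion \<Gamma>) (carrier (profinite_completion \<Gamma>)) V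
        \<longleftrightarrow> maximal_among (\<lambda>K. K \<lhd> \<Gamma>) (carrier \<Gamma>) (c.pullback V)"
      if W: "W \<in> congruence_kernel ` finite_index_normal \<Gamma>"
        and V: "subgroup V (profinite_completion \<Gamma>)" "W \<subseteq> V"
      for W V
      using c.normal_iff_pullback_normal[OF c.normal[OF W] c.dense[OF W]]
      by (intro c.maximal_iff_pullback_maximal[OF c.normal[OF W] c.dense[OF W] V])
        (simp_all add: normal_imp_subgroup)
  qed (simp_all add: maximal_among_def normal_imp_subgroup)
  ultimately show ?thesis
    by blast
qed

end
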